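(* Let $E$ be a Polish space, $\alpha$ a probability measure on $E$, and $\Phi:E\times E\to\mathbb{R}$ a bounded pair interaction potential. Let $(\mathrm{GRG}_{N,w})_{N\in\mathbb{N}}$ be a sequence of generalized random graphs whose weights satisfy: there is a random variable $W$ such that, as $N\to\infty$, (i) $W_N\to W$ in distribution and (ii) $\mathbb{E}[W_N^2]=\frac1N\sum_{i=1}^N w_i^2\to\mathbb{E}[W^2]<\infty$. If the thermodynamic limit $\psi(\Phi,P,\alpha)=\lim_{N\to\infty}\psi_N^w(\Phi,\alpha)$ of the annealed pressure exists, then the pressure is given by $$\psi(\Phi,P,\alpha)=\lim_{N\to\infty}\frac1N\log\alpha^{N}\Bigl(\exp\bigl(N\,L_N^{(\sigma,w)}\otimes L_N^{(\sigma,w)}(U)\bigr)\Bigr),$$ where $U:E^2\times(0,\infty)^2\to\mathbb{R}$ is given by $$U(\sigma,\sigma',w,w')=\frac{ww'}{2\,\mathbb{E}[W]}\,e^{\Phi(\sigma,\sigma')}.$$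
   Context: Generalized random graph: given weights $w_1,\dots,w_N\in(0,\infty)$, put $l_N=\sum_{i=1}^N w_i$. The graph $\mathrm{GRG}_{N,w}$ has vertex set $[N]=\{1,\dots,N\}$, and an edge between vertices $i$ and $j$ ($i\ne j$) is present, independently of all other edges, with probability $p_{ij}=\frac{w_iw_j}{l_N+w_iw_j}$. Its law (and expectation) is $Q_N^w$ and its random edge set is $E_N$. $W_N=w_{V_N}$, where $V_N$ is uniform on $[N]$; $P$ denotes the law of $W$. Annealed pressure at size $N$: $\psi_N^w(\Phi,\alpha)=\frac1N\log Q_N^w\,\alpha^{N}\bigl(e^{\sum_{(i,j)\in E_N}\Phi(\sigma_i,\sigma_j)}\bigr)$, where $\alpha^N(\cdot)$ denotes integration of $\sigma=(\sigma_1,\dots,\sigma_N)$ with respect to the $N$-fold product of $\alpha$ and each edge is counted once. $L_N^{(\sigma,w)}=\frac1N\sum_{i=1}^N\delta_{(\sigma_i,w_i)}$ is the joint empirical distribution of spins and weights, and $L_N^{(\sigma,w)}\otimes L_N^{(\sigma,w)}(U)=\frac1{N^2}\sum_{i,j=1}^N U(\sigma_i,\sigma_j,w_i,w_j)$.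
   Formalization: The formal U has e^Φ − 1 in place of e^Φ, since the printed formula is off by E[W]/2 (Φ=0, all weights 1: the pressure is 0 but the printed limit is 1/2); Φ is also taken symmetric, so that the sum over undirected edges is well defined, and Borel measurable. *)

theory Defs
  imports "HOL-Probability.Probability"
begin

section \<open>Generalized random graphs\<close>

definition vertex_pairs :: "nat \<Rightarrow> (nat \<times> nat) set" where
  "vertex_pairs N = {(i, j). 1 \<le> i \<and> i < j \<and> j \<le> N}"

definition edge_prob :: "nat \<Rightarrow> (nat \<Rightarrow> real) \<Rightarrow> nat \<times> nat \<Rightarrow> real" where
  "edge_prob N w = (\<lambda>(i, j). w i * w j / ((\<Sum>k = 1..N. w k) + w i * w j))"

text \<open>The law of the random edge set. An undirected edge between \<open>i\<close> and \<open>j\<close> is represented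
  by the pair with its smaller endpoint first, so that a sum over the edge set counts every edge
  once.\<close>

definition GRG :: "nat \<Rightarrow> (nat \<Rightarrow> real) \<Rightarrow> (nat \<times> nat) set pmf" where
  "GRG N w = map_pmf (\<lambda>X. {e \<in> vertex_pairs N. X e})
     (Pi_pmf (vertex_pairs N) False (\<lambda>e. bernoulli_pmf (edge_prob N w e)))"

section \<open>Annealed pressure\<close>

abbreviation spin_product :: "'a measure \<Rightarrow> nat \<Rightarrow> (nat \<Rightarrow> 'a) measure" where
  "spin_product \<alpha> N \<equiv> PiM {1..N} (\<lambda>_. \<alpha>)"

definition annealed_pressure ::
    "('a \<times> 'a \<Rightarrow> real) \<Rightarrow> 'a measure \<Rightarrow> (nat \<Rightarrow> real) \<Rightarrow> nat \<Rightarrow> real" where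
  "annealed_pressure \<Phi> \<alpha> w N =
     1 / real N * ln (measure_pmf.expectation (GRG N w)
       (\<lambda>E. \<integral>\<sigma>. exp (\<Sum>(i, j)\<in>E. \<Phi> (\<sigma> i, \<sigma> j)) \<partial>spin_product \<alpha> N))"

section \<open>Empirical distributions\<close>

text \<open>The law of \<open>x\<^sub>V\<close> for \<open>V\<close> uniform on \<open>{1..N}\<close>, that is,
  \<open>1/N * (\<delta>\<^bsub>x 1\<^esub> + \<dots> + \<delta>\<^bsub>x N\<^esub>)\<close>; only meaningful for \<open>N > 0\<close>.\<close>

definition empirical :: "nat \<Rightarrow> (nat \<Rightarrow> 'a) \<Rightarrow> 'a pmf" where
  "empirical N x = map_pmf x (pmf_of_set {1..N})"

definition empirical_square ::
    "nat \<Rightarrow> (nat \<Rightarrow> 'a) \<Rightarrow> (nat \<Rightarrow> real) \<Rightarrow> ('a \<times> 'a \<times> real \<times> real \<Rightarrow> real) \<Rightarrow> real" where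
  "empirical_square N \<sigma> w U =
     (let L = empirical N (\<lambda>i. (\<sigma> i, w i)) in
        measure_pmf.expectation (pair_pmf L L) (\<lambda>((s, v), (s', v')). U (s, s', v, v')))"

lemma expectation_empirical:
  fixes f :: "'a \<Rightarrow> real"
  assumes "N > 0"
  shows "measure_pmf.expectation (empirical N x) f = (\<Sum>i = 1..N. f (x i)) / N"
  using assms unfolding empirical_def by (simp add: integral_pmf_of_set)

lemma empirical_square_eq:
  assumes "N > 0"
  shows "empirical_square N \<sigma> w U =
    1 / (real N)\<^sup>2 * (\<Sum>i = 1..N. \<Sum>j = 1..N. U (\<sigma> i, \<sigma> j, w i, w j))"
proof -
  let ?u = "pmf_of_set {1..N}"
  have u: "pair_pmf ?u ?u = pmf_of_set ({1..N} \<times> {1..N})"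
    using assms by (intro pmf_eqI) (auto simp: pmf_pair indicator_def split: if_splits)
  have "empirical_square N \<sigma> w U =
      measure_pmf.expectation (pair_pmf ?u ?u) (\<lambda>(i, j). U (\<sigma> i, \<sigma> j, w i, w j))"
    unfolding empirical_square_def empirical_def Let_def
    by (simp add: map_pair [symmetric] case_prod_unfold)
  also have "\<dots> = (\<Sum>(i, j)\<in>{1..N} \<times> {1..N}. U (\<sigma> i, \<sigma> j, w i, w j)) / (real N)\<^sup>2"
    using assms by (subst u, subst integral_pmf_of_set) (auto simp: power2_eq_square)
  finally show ?thesis
    by (simp add: sum.cartesian_product)
qed

section \<open>The mean-field interaction\<close>

text \<open>Here \<open>m\<close> stands for the mean of the limiting weight. The edge factor
  \<open>1 + p\<^sub>i\<^sub>j * (exp (\<Phi> (\<sigma>\<^sub>i, \<sigma>\<^sub>j)) - 1)\<close> with \<open>p\<^sub>i\<^sub>j \<approx> w\<^sub>i * w\<^sub>j / (N * m)\<close> produces the summand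
  \<open>- 1\<close>. Sources that print this interaction without it are off by the additive constant
  \<open>m / 2\<close> in the pressure: for \<open>\<Phi> = 0\<close> the annealed pressure vanishes for every \<open>N\<close>, whereas
  \<open>v * v' / (2 * m)\<close> would give the limit \<open>m / 2\<close>.\<close>

definition interaction ::
    "('a \<times> 'a \<Rightarrow> real) \<Rightarrow> real \<Rightarrow> 'a \<times> 'a \<times> real \<times> real \<Rightarrow> real" where
  "interaction \<Phi> m = (\<lambda>(s, s', v, v'). v * v' / (2 * m) * (exp (\<Phi> (s, s')) - 1))"

end

theory Submission
  imports Defs
begin

text \<open>Averaging over the independent edges turns the annealed partition function into the integral
  of \<open>exp F\<close> with \<open>F(\<sigma>) = \<Sum>\<^bsub>i<j\<^esub> ln (1 + p\<^sub>i\<^sub>j * (exp (\<Phi>(\<sigma>\<^sub>i, \<sigma>\<^sub>j)) - 1))\<close>. Writing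
  \<open>S = \<Sum>\<^sub>i w\<^sub>i\<close>, \<open>T = \<Sum>\<^sub>i w\<^sub>i\<^sup>2\<close> and \<open>m\<close> for the mean of the limiting weight, replacing the \<open>(i, j)\<close>
  summand by its linearization in \<open>w\<^sub>i * w\<^sub>j / S\<close> costs \<open>O((w\<^sub>i * w\<^sub>j / S)\<^sup>2)\<close>, in total
  \<open>O((T / S)\<^sup>2) = O(1)\<close>; replacing \<open>S\<close> by \<open>N * m\<close> then costs \<open>O(S\<^sup>2 * \<bar>1 / S - 1 / (N * m)\<bar>) = o(N)\<close>
  because \<open>S / N\<close> tends to \<open>m\<close>; and the diagonal terms of the empirical square are \<open>O(T / N) = O(1)\<close>.
  All bounds are uniform in \<open>\<sigma>\<close>, so the two pressures differ by \<open>o(1)\<close>. For \<open>m = 0\<close> both tend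
  to zero, since \<open>F = O(S)\<close>.\<close>

section \<open>Convergence of the mean weight\<close>

text \<open>Clipping to \<open>[-R, R]\<close> moves only points with
  \<open>\<bar>x\<bar> > R\<close>, and those by at most
  \<open>\<bar>x\<bar> \<le> x\<^sup>2 / R\<close>. The second moment thus controls the error at
  rate \<open>1 / R\<close>.\<close>

lemma truncation_error_le:
  assumes "real_distribution M" "integrable M (\<lambda>x. x\<^sup>2)" "0 < R"
  shows "\<bar>(\<integral>x. x \<partial>M) - (\<integral>x. max (- R) (min R x) \<partial>M)\<bar> \<le> (\<integral>x. x\<^sup>2 \<partial>M) / R"
proof -
  interpret real_distribution M by fact
  have int: "integrable M (\<lambda>x. x)"
    by (rule square_integrable_imp_integrable[OF _ assms(2)]) (simp add: measurable_ident_sets)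
  have int_trunc: "integrable M (\<lambda>x. max (- R) (min R x))"
    using assms(3) by (intro integrable_const_bound[where B = R] AE_I2) auto
  have le: "\<bar>x - max (- R) (min R x)\<bar> \<le> x\<^sup>2 / R" for x
  proof (cases "\<bar>x\<bar> \<le> R")
    case False
    then have "\<bar>x\<bar> * R \<le> \<bar>x\<bar> * \<bar>x\<bar>" by (intro mult_left_mono) auto
    then have "\<bar>x\<bar> \<le> x\<^sup>2 / R"
      using assms(3) by (simp add: field_simps power2_eq_square)
    moreover have "\<bar>x - max (- R) (min R x)\<bar> \<le> \<bar>x\<bar>" using assms(3) by auto
    ultimately show ?thesis by linarith
  qed (use assms(3) in auto)
  have "\<bar>(\<integral>x. x \<partial>M) - (\<integral>x. max (- R) (min R x) \<partial>M)\<bar> \<le> (\<integral>x. \<bar>x - max (- R) (min R x)\<bar> \<partial>M)"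
    unfolding Bochner_Integration.integral_diff[OF int int_trunc, symmetric]
    by (rule integral_abs_bound)
  also have "\<dots> \<le> (\<integral>x. x\<^sup>2 / R \<partial>M)"
    using int int_trunc assms(2) le by (intro integral_mono) auto
  finally show ?thesis by simp
qed

text \<open>Weak convergence does not apply to the unbounded identity directly. Eventually bounded
  second moments make its truncation error small uniformly in \<open>n\<close>, and the clipped
  identity is bounded and continuous.\<close>

lemma weak_conv_imp_mean_conv:
  assumes "\<And>n. real_distribution (\<mu> n)" "real_distribution M" "weak_conv_m \<mu> M"
    and "\<forall>\<^sub>F n in sequentially. integrable (\<mu> n) (\<lambda>x. x\<^sup>2)" "integrable M (\<lambda>x. x\<^sup>2)"
    and "(\<lambda>n. \<integral>x. x\<^sup>2 \<partial>\<mu> n) \<longlonglongrightarrow> L"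
  shows "(\<lambda>n. \<integral>x. x \<partial>\<mu> n) \<longlonglongrightarrow> (\<integral>x. x \<partial>M)"
proof (rule tendstoI)
  fix e :: real assume e: "0 < e"
  \<comment> \<open>\<open>B\<close> dominates the second moment of \<open>M\<close> and,
    eventually, that of every \<open>\<mu> n\<close>.\<close>
  define B where "B = max (L + 1) (\<integral>x. x\<^sup>2 \<partial>M)"
  have "0 \<le> (\<integral>x. x\<^sup>2 \<partial>M)" by (rule Bochner_Integration.integral_nonneg) simp
  then have B0: "0 \<le> B" unfolding B_def by linarith
  \<comment> \<open>Two truncation errors below \<open>e / 4\<close> and one weak-convergence error
    below \<open>e / 4\<close> stay below \<open>e\<close>. The \<open>+ 1\<close> keeps
    \<open>R\<close> positive when \<open>B = 0\<close>.\<close>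
  define R where "R = 4 * (B + 1) / e"
  have R: "0 < R" "B / R < e / 4" using e B0 by (auto simp: R_def field_simps)
  let ?t = "\<lambda>x. max (- R) (min R x)"
  have "(\<lambda>n. integral\<^sup>L (\<mu> n) ?t) \<longlonglongrightarrow> integral\<^sup>L M ?t"
    using assms(1,2,3) R(1)
    by (intro weak_conv_imp_integral_bdd_continuous_conv[where B = R]) (auto intro!: continuous_intros)
  then have "\<forall>\<^sub>F n in sequentially. dist (integral\<^sup>L (\<mu> n) ?t) (integral\<^sup>L M ?t) < e / 4"
    using e by (intro tendstoD) auto
  moreover have "\<forall>\<^sub>F n in sequentially. (\<integral>x. x\<^sup>2 \<partial>\<mu> n) < L + 1"
    using order_tendstoD(2)[OF assms(6)] by simp
  moreover note assms(4)
  ultimately show "\<forall>\<^sub>F n in sequentially. dist (\<integral>x. x \<partial>\<mu> n) (\<integral>x. x \<partial>M) < e"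
  proof eventually_elim
    case (elim n)
    have err: "\<bar>(\<integral>x. x \<partial>N) - integral\<^sup>L N ?t\<bar> < e / 4"
      if "real_distribution N" "integrable N (\<lambda>x. x\<^sup>2)" "(\<integral>x. x\<^sup>2 \<partial>N) \<le> B" for N
    proof -
      interpret N: real_distribution N by fact
      have "(\<integral>x. x\<^sup>2 \<partial>N) / R \<le> B / R" using that(3) R(1) by (simp add: divide_right_mono)
      then show ?thesis
        using truncation_error_le[OF that(1,2) R(1)] R(2) by linarith
    qed
    have "(\<integral>x. x\<^sup>2 \<partial>\<mu> n) \<le> B" "(\<integral>x. x\<^sup>2 \<partial>M) \<le> B" using elim by (auto simp: B_def)
    then show ?case
      using err[OF assms(1) elim(3)] err[OF assms(2,5)] elim(1) e unfolding dist_real_def by linarith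
  qed
qed

section \<open>The annealed partition function\<close>

lemma finite_vertex_pairs [simp]: "finite (vertex_pairs N)"
  by (rule finite_subset[of _ "{1..N} \<times> {1..N}"]) (auto simp: vertex_pairs_def)

lemma set_pmf_GRG: "set_pmf (GRG N w) \<subseteq> Pow (vertex_pairs N)"
  by (auto simp: GRG_def)

lemma finite_set_pmf_GRG: "finite (set_pmf (GRG N w))"
  by (rule finite_subset[OF set_pmf_GRG]) simp

text \<open>The exponential is a product over all pairs of independent factors, equal to
  \<open>exp (f e)\<close> if the edge is present and to 1 otherwise. Independence lets the
  expectation pass into the product.\<close>

lemma GRG_expectation_exp_sum:
  assumes "\<And>e. e \<in> vertex_pairs N \<Longrightarrow> 0 \<le> edge_prob N w e \<and> edge_prob N w e \<le> 1"
  shows "measure_pmf.expectation (GRG N w) (\<lambda>E. exp (\<Sum>e\<in>E. f e)) =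
    (\<Prod>e\<in>vertex_pairs N. 1 + edge_prob N w e * (exp (f e) - 1))"
proof -
  let ?V = "vertex_pairs N"
  have "exp (\<Sum>e\<in>{e\<in>?V. X e}. f e) = (\<Prod>e\<in>?V. if X e then exp (f e) else 1)" for X
    by (simp add: exp_sum prod.inter_filter)
  then have "measure_pmf.expectation (GRG N w) (\<lambda>E. exp (\<Sum>e\<in>E. f e)) =
      (\<Prod>e\<in>?V. measure_pmf.expectation (bernoulli_pmf (edge_prob N w e))
        (\<lambda>b. if b then exp (f e) else 1))"
    unfolding GRG_def
    by (simp only: integral_map_pmf)
      (subst expectation_prod_Pi_pmf, auto intro!: integrable_measure_pmf_finite)
  also have "\<dots> = (\<Prod>e\<in>?V. 1 + edge_prob N w e * (exp (f e) - 1))"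
    using assms by (intro prod.cong refl) (simp add: algebra_simps)
  finally show ?thesis .
qed

text \<open>With finite support the exchange is linearity of the integral rather than
  Fubini.\<close>

lemma expectation_integral_swap:
  fixes f :: "'a \<Rightarrow> 'b \<Rightarrow> real"
  assumes "finite (set_pmf p)" "\<And>x. x \<in> set_pmf p \<Longrightarrow> integrable M (f x)"
  shows "measure_pmf.expectation p (\<lambda>x. \<integral>y. f x y \<partial>M) = (\<integral>y. measure_pmf.expectation p (\<lambda>x. f x y) \<partial>M)"
  using assms by (subst (1 2) integral_measure_pmf[of "set_pmf p"]) (auto simp: Bochner_Integration.integral_sum)

text \<open>Pointwise \<open>exp F\<close> and \<open>exp G\<close> agree up to a factor
  \<open>exp D\<close>, hence so do their integrals. The bound \<open>B\<close> makes both
  integrable with positive integral, so that the logarithms behave, but does not enter the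
  estimate.\<close>

lemma ln_integral_exp_diff_le:
  fixes F G :: "'a \<Rightarrow> real"
  assumes "prob_space M" "F \<in> borel_measurable M" "G \<in> borel_measurable M"
    and F: "\<And>x. x \<in> space M \<Longrightarrow> \<bar>F x\<bar> \<le> B"
    and FG: "\<And>x. x \<in> space M \<Longrightarrow> \<bar>F x - G x\<bar> \<le> D"
  shows "\<bar>ln (\<integral>x. exp (F x) \<partial>M) - ln (\<integral>x. exp (G x) \<partial>M)\<bar> \<le> D"
proof -
  interpret prob_space M by fact
  note [measurable] = assms(2,3)
  have G: "\<bar>G x\<bar> \<le> B + D" if "x \<in> space M" for x
    using F[OF that] FG[OF that] by linarith
  have int: "integrable M (\<lambda>x. exp (H x))"
    if "\<And>x. x \<in> space M \<Longrightarrow> \<bar>H x\<bar> \<le> C" "H \<in> borel_measurable M" for H :: "'a \<Rightarrow> real" and C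
    using that by (intro integrable_const_bound[where B = "exp C"] AE_I2) (auto simp: abs_le_iff)
  have pos: "0 < (\<integral>x. exp (H x) \<partial>M)"
    if "\<And>x. x \<in> space M \<Longrightarrow> \<bar>H x\<bar> \<le> C" "H \<in> borel_measurable M" for H :: "'a \<Rightarrow> real" and C
  proof -
    have "exp (- C) \<le> (\<integral>x. exp (H x) \<partial>M)"
      using that(1) by (intro integral_ge_const int[OF that] AE_I2) (fastforce simp: abs_le_iff)+
    then show ?thesis using exp_gt_zero[of "- C"] by linarith
  qed
  \<comment> \<open>The one-sided estimate is applied to \<open>F, G\<close> and to
    \<open>G, F\<close>. The bound \<open>B + \<bar>D\<bar>\<close> is common to both functions
    without first deriving \<open>0 \<le> D\<close>.\<close>
  have "ln (\<integral>x. exp (H x) \<partial>M) \<le> D + ln (\<integral>x. exp (J x) \<partial>M)"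
    if H: "\<And>x. x \<in> space M \<Longrightarrow> \<bar>H x\<bar> \<le> B + \<bar>D\<bar>" "H \<in> borel_measurable M"
      and J: "\<And>x. x \<in> space M \<Longrightarrow> \<bar>J x\<bar> \<le> B + \<bar>D\<bar>" "J \<in> borel_measurable M"
      and HJ: "\<And>x. x \<in> space M \<Longrightarrow> \<bar>H x - J x\<bar> \<le> D" for H J
  proof -
    have "(\<integral>x. exp (H x) \<partial>M) \<le> (\<integral>x. exp D * exp (J x) \<partial>M)"
    proof (rule integral_mono)
      fix x assume "x \<in> space M"
      then show "exp (H x) \<le> exp D * exp (J x)"
        using HJ[of x] by (simp add: exp_add[symmetric] abs_le_iff)
    qed (use int[OF H] int[OF J] in auto)
    also have "\<dots> = exp D * (\<integral>x. exp (J x) \<partial>M)" by simp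
    finally have "ln (\<integral>x. exp (H x) \<partial>M) \<le> ln (exp D * (\<integral>x. exp (J x) \<partial>M))"
      using pos[OF H] by simp
    then show ?thesis using pos[OF J] by (simp add: ln_mult)
  qed
  moreover have "\<bar>F x\<bar> \<le> B + \<bar>D\<bar>" "\<bar>G x\<bar> \<le> B + \<bar>D\<bar>" if "x \<in> space M" for x
    using F[OF that] G[OF that] by linarith+
  moreover have "\<bar>G x - F x\<bar> \<le> D" if "x \<in> space M" for x
    using FG[OF that] by linarith
  ultimately have "ln (\<integral>x. exp (F x) \<partial>M) \<le> D + ln (\<integral>x. exp (G x) \<partial>M)"
      "ln (\<integral>x. exp (G x) \<partial>M) \<le> D + ln (\<integral>x. exp (F x) \<partial>M)"
    using FG assms(2,3) by blast+
  then show ?thesis by (simp add: abs_le_iff)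
qed

section \<open>Linearization of the edge factors\<close>

text \<open>Both bounds come from \<open>y / (1 + y) \<le> ln (1 + y) \<le> y\<close>: the two sides
  differ by \<open>y\<^sup>2 / (1 + y)\<close>, and \<open>1 / (1 + y) \<le> K\<close>.\<close>

lemma abs_ln_one_plus_le:
  assumes "1 / K \<le> 1 + (y::real)" "1 \<le> K"
  shows "\<bar>ln (1 + y)\<bar> \<le> K * \<bar>y\<bar>"
    and "\<bar>ln (1 + y) - y\<bar> \<le> K * y\<^sup>2"
proof -
  have "0 < 1 / K" using assms(2) by simp
  then have y: "0 < 1 + y" using assms(1) by linarith
  have inv: "1 / (1 + y) \<le> K" using assms y by (simp add: field_simps)
  have up: "ln (1 + y) \<le> y" using y by (intro ln_add_one_self_le_self2) simp
  have lo: "y / (1 + y) \<le> ln (1 + y)" using ln_diff_le[of 1 "1 + y"] y by simp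
  have "\<bar>y\<bar> * (1 / (1 + y)) \<le> \<bar>y\<bar> * K" using inv by (intro mult_left_mono) auto
  then have "- (K * \<bar>y\<bar>) \<le> y / (1 + y)" using y by (auto simp: abs_if field_simps split: if_splits)
  moreover have "1 * \<bar>y\<bar> \<le> K * \<bar>y\<bar>" using assms(2) by (intro mult_right_mono) auto
  ultimately show "\<bar>ln (1 + y)\<bar> \<le> K * \<bar>y\<bar>" using up lo by (simp add: abs_le_iff)
  have "y\<^sup>2 * (1 / (1 + y)) \<le> y\<^sup>2 * K" using inv by (intro mult_left_mono) auto
  moreover have "y / (1 + y) = y - y\<^sup>2 * (1 / (1 + y))" using y by (simp add: field_simps power2_eq_square)
  ultimately show "\<bar>ln (1 + y) - y\<bar> \<le> K * y\<^sup>2" using up lo by (simp add: abs_le_iff mult.commute)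
qed

text \<open>The factor is the convex combination \<open>(1 - p) * 1 + p * (1 + x)\<close> of two
  numbers that are at least \<open>1 / K\<close>.\<close>

lemma edge_factor_ge:
  assumes "0 \<le> p" "p \<le> (1::real)" "1 / K \<le> 1 + x" "1 \<le> K"
  shows "1 / K \<le> 1 + p * x"
proof -
  have "p * (1 / K) \<le> p * (1 + x)" using assms by (intro mult_left_mono) auto
  moreover have "(1 - p) * (1 / K) \<le> (1 - p)" using assms mult_left_mono[of "1 / K" 1 "1 - p"] by auto
  ultimately have "p * (1 / K) + (1 - p) * (1 / K) \<le> p * (1 + x) + (1 - p)" by linarith
  then show ?thesis by (simp only: ring_distribs(2)[symmetric]) (simp add: algebra_simps)
qed

text \<open>Two errors add up, each at most \<open>K ^ 3 * (a / l)\<^sup>2\<close>: replacing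
  \<open>ln (1 + p * x)\<close> by \<open>p * x\<close>, and replacing
  \<open>p = a / (l + a)\<close> by \<open>a / l\<close>, where the gap is exactly
  \<open>p * (a / l)\<close>.\<close>

lemma ln_edge_factor_linearization:
  assumes "0 < a" "0 < l" "\<bar>x\<bar> \<le> K" "1 / K \<le> 1 + x" "1 \<le> (K::real)"
  shows "\<bar>ln (1 + a / (l + a) * x) - a / l * x\<bar> \<le> 2 * K ^ 3 * (a / l)\<^sup>2"
proof -
  define p where "p = a / (l + a)"
  have p: "0 \<le> p" "p \<le> 1" "p \<le> a / l" using assms by (auto simp: p_def frac_le)
  have pl: "a / l - p = p * (a / l)" using assms by (simp add: p_def field_simps)
  have "\<bar>p * x\<bar> \<le> a / l * K"
    unfolding abs_mult using p assms by (intro mult_mono) auto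
  then have "(p * x)\<^sup>2 \<le> (a / l * K)\<^sup>2" by (metis abs_ge_zero power2_abs power_mono)
  then have "K * (p * x)\<^sup>2 \<le> K * (a / l * K)\<^sup>2" using assms by (intro mult_left_mono) auto
  also have "\<dots> = K ^ 3 * (a / l)\<^sup>2" by (simp only: power2_eq_square power3_eq_cube mult_ac)
  finally have 1: "\<bar>ln (1 + p * x) - p * x\<bar> \<le> K ^ 3 * (a / l)\<^sup>2"
    using abs_ln_one_plus_le(2)[OF edge_factor_ge[OF p(1,2) assms(4,5)] assms(5)] by linarith
  have "\<bar>p * x - a / l * x\<bar> = (p * (a / l)) * \<bar>x\<bar>"
  proof -
    have "\<bar>p * x - a / l * x\<bar> = \<bar>p - a / l\<bar> * \<bar>x\<bar>"
      by (simp only: left_diff_distrib[symmetric] abs_mult)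
    also have "\<bar>p - a / l\<bar> = p * (a / l)" unfolding pl[symmetric] using p(3) by linarith
    finally show ?thesis .
  qed
  also have "\<dots> \<le> (a / l * (a / l)) * K ^ 3"
  proof -
    \<comment> \<open>This error needs only one factor \<open>K\<close>; it is enlarged to
      \<open>K ^ 3\<close> to match the first one.\<close>
    have "1 * K \<le> K\<^sup>2 * K" using assms(5) by (intro mult_right_mono) auto
    then have "\<bar>x\<bar> \<le> K ^ 3" using assms(3) by (simp add: power3_eq_cube power2_eq_square)
    then show ?thesis using p assms by (intro mult_mono) auto
  qed
  finally have "\<bar>p * x - a / l * x\<bar> \<le> K ^ 3 * (a / l)\<^sup>2" by (simp add: power2_eq_square mult_ac)
  with 1 show ?thesis unfolding p_def[symmetric] by linarith
qed

text \<open>The square splits into the pairs above the diagonal, their mirror images and the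
  diagonal. The factor 2 cancels the 2 in the denominator of \<open>interaction\<close>, so that
  each edge is counted once.\<close>

lemma sum_symmetric_eq_vertex_pairs:
  fixes f :: "nat \<Rightarrow> nat \<Rightarrow> 'a::comm_semiring_1"
  assumes "\<And>i j. f i j = f j i"
  shows "(\<Sum>i = 1..N. \<Sum>j = 1..N. f i j) =
    2 * (\<Sum>(i, j)\<in>vertex_pairs N. f i j) + (\<Sum>i = 1..N. f i i)"
proof -
  let ?V = "vertex_pairs N" and ?D = "(\<lambda>i. (i, i)) ` {1..N}" and ?g = "\<lambda>(i, j). f i j"
  have split: "{1..N} \<times> {1..N} = (?V \<union> prod.swap ` ?V) \<union> ?D"
    by (auto simp: vertex_pairs_def image_iff)
  have "(\<Sum>i = 1..N. \<Sum>j = 1..N. f i j) = sum ?g ({1..N} \<times> {1..N})"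
    by (simp add: sum.cartesian_product)
  also have "\<dots> = sum ?g (?V \<union> prod.swap ` ?V) + sum ?g ?D"
    unfolding split
    by (rule sum.union_disjoint, simp, simp) (auto simp: vertex_pairs_def)
  also have "sum ?g (?V \<union> prod.swap ` ?V) = sum ?g ?V + sum ?g (prod.swap ` ?V)"
    by (rule sum.union_disjoint, simp, simp) (auto simp: vertex_pairs_def)
  also have "sum ?g (prod.swap ` ?V) = sum ?g ?V"
    by (subst sum.reindex) (auto intro!: sum.cong simp: assms)
  also have "sum ?g ?D = (\<Sum>i = 1..N. f i i)"
    by (subst sum.reindex) (auto simp: inj_on_def)
  finally show ?thesis by (simp add: mult_2)
qed

text \<open>Nonnegative terms allow enlarging the index set to the full square, where the sum
  factors.\<close>

lemma sum_vertex_pairs_le: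
  fixes g :: "nat \<Rightarrow> real"
  assumes "\<And>i. i \<in> {1..N} \<Longrightarrow> 0 \<le> g i"
  shows "(\<Sum>(i, j)\<in>vertex_pairs N. g i * g j) \<le> (\<Sum>i = 1..N. g i)\<^sup>2"
proof -
  have "(\<Sum>(i, j)\<in>vertex_pairs N. g i * g j) \<le> (\<Sum>(i, j)\<in>{1..N} \<times> {1..N}. g i * g j)"
    using assms by (intro sum_mono2) (auto simp: vertex_pairs_def)
  then show ?thesis by (simp add: power2_eq_square sum_product sum.cartesian_product)
qed

section \<open>Comparison with the mean-field partition function\<close>

text \<open>The single constant \<open>K = exp C\<close> meets all requirements on
  \<open>x = exp y - 1\<close> in the linearization.\<close>

lemma exp_minus_one_bounds:
  assumes "\<bar>y\<bar> \<le> (C::real)"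
  shows "\<bar>exp y - 1\<bar> \<le> exp C" "1 / exp C \<le> 1 + (exp y - 1)" "1 \<le> exp C"
proof -
  have "exp y \<le> exp C" "exp (- C) \<le> exp y" "1 \<le> exp C" using assms by (auto simp: abs_le_iff)
  then show "\<bar>exp y - 1\<bar> \<le> exp C" "1 / exp C \<le> 1 + (exp y - 1)" "1 \<le> exp C"
    using exp_gt_zero[of y] unfolding abs_le_iff by ((simp add: exp_minus field_simps; fail) | linarith)+
qed

section \<open>Reduction to a deterministic exponent, with bounds uniform in the spins\<close>

lemma edge_prob_bounds:
  assumes "\<And>i. i \<in> {1..N} \<Longrightarrow> 0 < w i" "e \<in> vertex_pairs N"
  shows "0 \<le> edge_prob N w e" "edge_prob N w e \<le> 1"
proof -
  obtain i j where e: "e = (i, j)" "i \<in> {1..N}" "j \<in> {1..N}"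
    using assms(2) by (auto simp: vertex_pairs_def)
  have "0 < w i * w j" "0 \<le> (\<Sum>k = 1..N. w k)"
    using assms(1) e by (simp, intro sum_nonneg less_imp_le assms(1))
  then show "0 \<le> edge_prob N w e" "edge_prob N w e \<le> 1"
    by (simp_all add: e edge_prob_def)
qed

text \<open>Second countability of the spin space makes the pair of two Borel coordinates Borel on
  the product space, where \<open>\<Phi>\<close> is assumed measurable.\<close>

lemma measurable_pair_interaction:
  fixes \<Phi> :: "'a::polish_space \<times> 'a \<Rightarrow> real"
  assumes "sets \<alpha> = sets borel" "\<Phi> \<in> borel_measurable borel" "i \<in> {1..N}" "j \<in> {1..N}"
  shows "(\<lambda>\<sigma>. \<Phi> (\<sigma> i, \<sigma> j)) \<in> borel_measurable (spin_product \<alpha> N)"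
proof -
  have comp: "(\<lambda>\<sigma>. \<sigma> k) \<in> borel_measurable (spin_product \<alpha> N)" if "k \<in> {1..N}" for k
    using measurable_component_singleton[OF that, of "\<lambda>_. \<alpha>"] assms(1)
    by (simp cong: measurable_cong_sets)
  have "(\<lambda>\<sigma>. (\<sigma> i, \<sigma> j)) \<in> borel_measurable (spin_product \<alpha> N)"
    using assms(3,4) by (intro borel_measurable_Pair comp)
  then show ?thesis by (rule measurable_compose[OF _ assms(2)])
qed

text \<open>Averaging over the edges at fixed spins turns the partition function into the integral
  of \<open>exp F\<close>, with \<open>F\<close> the sum of the logarithms of the edge factors. A
  bound on \<open>F - G\<close> uniform in the spins then passes to the logarithms of the
  integrals.\<close>

lemma annealed_pressure_diff_le:
  fixes \<Phi> :: "'a::polish_space \<times> 'a \<Rightarrow> real"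
  assumes "prob_space \<alpha>" "sets \<alpha> = sets borel" "\<Phi> \<in> borel_measurable borel"
    and C: "\<And>z. \<bar>\<Phi> z\<bar> \<le> C"
    and w: "\<And>i. i \<in> {1..N} \<Longrightarrow> 0 < w i"
    and G: "G \<in> borel_measurable (spin_product \<alpha> N)"
    and D: "\<And>\<sigma>. \<bar>(\<Sum>(i, j)\<in>vertex_pairs N.
        ln (1 + edge_prob N w (i, j) * (exp (\<Phi> (\<sigma> i, \<sigma> j)) - 1))) - G \<sigma>\<bar> \<le> D"
  shows "\<bar>annealed_pressure \<Phi> \<alpha> w N - 1 / real N * ln (\<integral>\<sigma>. exp (G \<sigma>) \<partial>spin_product \<alpha> N)\<bar>
    \<le> D / real N"
proof -
  let ?M = "spin_product \<alpha> N" and ?V = "vertex_pairs N" and ?p = "edge_prob N w"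
  let ?y = "\<lambda>\<sigma> e. ?p e * (exp (\<Phi> (\<sigma> (fst e), \<sigma> (snd e))) - 1)"
  let ?F = "\<lambda>\<sigma>. \<Sum>e\<in>?V. ln (1 + ?y \<sigma> e)"
  interpret M: prob_space ?M using assms(1) by (intro prob_space_PiM)
  have meas: "(\<lambda>\<sigma>. \<Phi> (\<sigma> (fst e), \<sigma> (snd e))) \<in> borel_measurable ?M" if "e \<in> ?V" for e
    using that by (intro measurable_pair_interaction assms(2,3)) (auto simp: vertex_pairs_def)
  note p = edge_prob_bounds[OF w]
  have y: "1 / exp C \<le> 1 + ?y \<sigma> e" if "e \<in> ?V" for \<sigma> e
    using p[OF _ that] exp_minus_one_bounds(2,3)[OF C] by (intro edge_factor_ge) auto
  have pos: "0 < 1 + ?y \<sigma> e" if "e \<in> ?V" for \<sigma> e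
    using y[OF that, of \<sigma>] by (rule less_le_trans[rotated]) simp
  have expF: "exp (?F \<sigma>) = (\<Prod>e\<in>?V. 1 + ?y \<sigma> e)" for \<sigma>
    using pos by (simp add: exp_sum)
  \<comment> \<open>This crude bound grows with the number of pairs; it serves only integrability
    and positivity.\<close>
  have bound: "\<bar>?F \<sigma>\<bar> \<le> (\<Sum>e\<in>?V. exp C * exp C)" for \<sigma>
  proof (rule order.trans[OF sum_abs], rule sum_mono)
    fix e assume e: "e \<in> ?V"
    have "\<bar>?y \<sigma> e\<bar> \<le> 1 * exp C"
      unfolding abs_mult using p[OF _ e] exp_minus_one_bounds(1)[OF C] by (intro mult_mono) auto
    then have "exp C * \<bar>?y \<sigma> e\<bar> \<le> exp C * exp C" by simp
    then show "\<bar>ln (1 + ?y \<sigma> e)\<bar> \<le> exp C * exp C"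
      using abs_ln_one_plus_le(1)[OF y[OF e, of \<sigma>] exp_minus_one_bounds(3)[OF C]] by linarith
  qed
  have "measure_pmf.expectation (GRG N w) (\<lambda>E. \<integral>\<sigma>. exp (\<Sum>(i, j)\<in>E. \<Phi> (\<sigma> i, \<sigma> j)) \<partial>?M) =
      (\<integral>\<sigma>. measure_pmf.expectation (GRG N w)
        (\<lambda>E. exp (\<Sum>e\<in>E. \<Phi> (\<sigma> (fst e), \<sigma> (snd e)))) \<partial>?M)"
    unfolding case_prod_unfold
  proof (rule expectation_integral_swap[OF finite_set_pmf_GRG])
    fix E assume "E \<in> set_pmf (GRG N w)"
    then have E: "E \<subseteq> ?V" using set_pmf_GRG by blast
    have "\<bar>\<Sum>e\<in>E. \<Phi> (\<sigma> (fst e), \<sigma> (snd e))\<bar> \<le> (\<Sum>e\<in>E. C)" for \<sigma>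
      by (rule order.trans[OF sum_abs], rule sum_mono) (rule C)
    then show "integrable ?M (\<lambda>\<sigma>. exp (\<Sum>e\<in>E. \<Phi> (\<sigma> (fst e), \<sigma> (snd e))))"
      using meas E
      by (intro M.integrable_const_bound[where B = "exp (\<Sum>e\<in>E. C)"]
          AE_I2 measurable_compose[OF _ borel_measurable_exp] borel_measurable_sum)
        (auto simp: abs_le_iff)
  qed
  also have "\<dots> = (\<integral>\<sigma>. exp (?F \<sigma>) \<partial>?M)"
    unfolding expF using p by (subst GRG_expectation_exp_sum) auto
  finally have eq: "annealed_pressure \<Phi> \<alpha> w N = 1 / real N * ln (\<integral>\<sigma>. exp (?F \<sigma>) \<partial>?M)"
    by (simp add: annealed_pressure_def)
  have "\<bar>ln (\<integral>\<sigma>. exp (?F \<sigma>) \<partial>?M) - ln (\<integral>\<sigma>. exp (G \<sigma>) \<partial>?M)\<bar> \<le> D"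
  proof (rule ln_integral_exp_diff_le[OF M.prob_space_axioms _ G bound])
    show "?F \<in> borel_measurable ?M" using meas by measurable
    show "\<bar>?F \<sigma> - G \<sigma>\<bar> \<le> D" for \<sigma> using D[of \<sigma>] by (simp add: case_prod_unfold)
  qed
  then have "\<bar>ln (\<integral>\<sigma>. exp (?F \<sigma>) \<partial>?M) - ln (\<integral>\<sigma>. exp (G \<sigma>) \<partial>?M)\<bar> / real N \<le> D / real N"
    by (simp add: divide_right_mono)
  then show ?thesis by (simp add: eq diff_divide_distrib[symmetric])
qed

text \<open>The three terms of the bound come, in order, from linearizing each edge factor in
  \<open>w i * w j / S\<close>, from replacing \<open>S\<close> by \<open>N * m\<close>, and from
  the diagonal of the empirical square, to which no edge corresponds.\<close>

lemma sum_ln_edge_factor_diff_le: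
  fixes \<Phi> :: "'a \<times> 'a \<Rightarrow> real" and w :: "nat \<Rightarrow> real"
  assumes C: "\<And>z. \<bar>\<Phi> z\<bar> \<le> C"
    and sym: "\<And>x y. \<Phi> (x, y) = \<Phi> (y, x)"
    and w: "\<And>i. i \<in> {1..N} \<Longrightarrow> 0 < w i"
    and N: "0 < N" and m: "0 < m"
  defines "S \<equiv> \<Sum>i = 1..N. w i" and "T \<equiv> \<Sum>i = 1..N. (w i)\<^sup>2"
  shows "\<bar>(\<Sum>(i, j)\<in>vertex_pairs N. ln (1 + edge_prob N w (i, j) * (exp (\<Phi> (\<sigma> i, \<sigma> j)) - 1)))
      - real N * empirical_square N \<sigma> w (interaction \<Phi> m)\<bar>
    \<le> 2 * exp C ^ 3 * (T / S)\<^sup>2 + exp C * \<bar>1 / S - 1 / (N * m)\<bar> * S\<^sup>2 + exp C / (2 * (N * m)) * T"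
proof -
  let ?V = "vertex_pairs N" and ?K = "exp C"
  define x where "x i j = exp (\<Phi> (\<sigma> i, \<sigma> j)) - 1" for i j
  have x: "\<bar>x i j\<bar> \<le> ?K" "1 / ?K \<le> 1 + x i j" for i j
    unfolding x_def using exp_minus_one_bounds[OF C] by blast+
  have K: "1 \<le> ?K" using exp_minus_one_bounds(3)[OF C] .
  have S: "0 < S" unfolding S_def using w N by (intro sum_pos) auto
  have "real N * empirical_square N \<sigma> w (interaction \<Phi> m) =
      1 / (2 * (N * m)) * (\<Sum>i = 1..N. \<Sum>j = 1..N. w i * w j * x i j)"
    using N m by (simp add: empirical_square_eq interaction_def x_def sum_distrib_left
        power2_eq_square mult_ac)
  also have "(\<Sum>i = 1..N. \<Sum>j = 1..N. w i * w j * x i j) =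
      2 * (\<Sum>(i, j)\<in>?V. w i * w j * x i j) + (\<Sum>i = 1..N. w i * w i * x i i)"
    using sym by (intro sum_symmetric_eq_vertex_pairs) (simp add: x_def mult_ac)
  finally have emp: "real N * empirical_square N \<sigma> w (interaction \<Phi> m) =
      (\<Sum>(i, j)\<in>?V. w i * w j / (N * m) * x i j) + 1 / (2 * (N * m)) * (\<Sum>i = 1..N. (w i)\<^sup>2 * x i i)"
    by (simp add: ring_distribs sum_distrib_left case_prod_unfold power2_eq_square)
  \<comment> \<open>The bound per pair is built from products \<open>g i * g j\<close> with
    \<open>g = w\<close> and \<open>g = w\<^sup>2\<close>, whose sums over pairs are at most
    \<open>S\<^sup>2\<close> and \<open>T\<^sup>2\<close>.\<close>
  have "\<bar>(\<Sum>(i, j)\<in>?V. ln (1 + edge_prob N w (i, j) * x i j)) - (\<Sum>(i, j)\<in>?V. w i * w j / (N * m) * x i j)\<bar>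
      \<le> (\<Sum>(i, j)\<in>?V. 2 * ?K ^ 3 / S\<^sup>2 * ((w i)\<^sup>2 * (w j)\<^sup>2) + ?K * \<bar>1 / S - 1 / (N * m)\<bar> * (w i * w j))"
    unfolding sum_subtractf[symmetric]
  proof (rule order.trans[OF sum_abs], rule sum_mono, unfold split_paired_all prod.case)
    fix i j assume "(i, j) \<in> ?V"
    then have a: "0 < w i * w j" using w by (auto simp: vertex_pairs_def)
    let ?a = "w i * w j"
    have 1: "\<bar>ln (1 + edge_prob N w (i, j) * x i j) - ?a / S * x i j\<bar> \<le> 2 * ?K ^ 3 * (?a / S)\<^sup>2"
      unfolding edge_prob_def prod.case S_def[symmetric]
      by (rule ln_edge_factor_linearization[OF a S x K])
    have 2: "(2 * ?K ^ 3 * (?a / S)\<^sup>2) = 2 * ?K ^ 3 / S\<^sup>2 * ((w i)\<^sup>2 * (w j)\<^sup>2)"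
      by (simp add: power_mult_distrib power_divide)
    have "?a / S * x i j - ?a / (N * m) * x i j = (?a * (1 / S - 1 / (N * m))) * x i j"
      by (simp add: algebra_simps)
    then have "\<bar>?a / S * x i j - ?a / (N * m) * x i j\<bar> = (?a * \<bar>1 / S - 1 / (N * m)\<bar>) * \<bar>x i j\<bar>"
      using a by (simp only: abs_mult[of _ "x i j"] abs_mult[of "w i * w j"] abs_of_pos)
    also have "\<dots> \<le> (?a * \<bar>1 / S - 1 / (N * m)\<bar>) * ?K"
      using a x by (intro mult_left_mono) auto
    finally have "\<bar>?a / S * x i j - ?a / (N * m) * x i j\<bar> \<le> ?K * \<bar>1 / S - 1 / (N * m)\<bar> * ?a"
      by (simp only: mult_ac)
    with 1 2 show "\<bar>ln (1 + edge_prob N w (i, j) * x i j) - ?a / (N * m) * x i j\<bar>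
      \<le> 2 * ?K ^ 3 / S\<^sup>2 * ((w i)\<^sup>2 * (w j)\<^sup>2) + ?K * \<bar>1 / S - 1 / (N * m)\<bar> * ?a"
      by linarith
  qed
  also have "\<dots> = 2 * ?K ^ 3 / S\<^sup>2 * (\<Sum>(i, j)\<in>?V. (w i)\<^sup>2 * (w j)\<^sup>2)
      + ?K * \<bar>1 / S - 1 / (N * m)\<bar> * (\<Sum>(i, j)\<in>?V. w i * w j)"
    by (simp only: case_prod_unfold sum.distrib sum_distrib_left)
  also have "\<dots> \<le> 2 * ?K ^ 3 / S\<^sup>2 * T\<^sup>2 + ?K * \<bar>1 / S - 1 / (N * m)\<bar> * S\<^sup>2"
    unfolding S_def T_def using w
    by (intro add_mono mult_left_mono sum_vertex_pairs_le) (auto intro: less_imp_le)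
  finally have offdiag: "\<bar>(\<Sum>(i, j)\<in>?V. ln (1 + edge_prob N w (i, j) * x i j))
      - (\<Sum>(i, j)\<in>?V. w i * w j / (N * m) * x i j)\<bar>
      \<le> 2 * ?K ^ 3 * (T / S)\<^sup>2 + ?K * \<bar>1 / S - 1 / (N * m)\<bar> * S\<^sup>2"
    by (simp add: power_divide)
  have "\<bar>\<Sum>i = 1..N. (w i)\<^sup>2 * x i i\<bar> \<le> (\<Sum>i = 1..N. (w i)\<^sup>2 * ?K)"
    by (rule order.trans[OF sum_abs], rule sum_mono) (simp add: abs_mult mult_left_mono x)
  then have "\<bar>1 / (2 * (N * m)) * (\<Sum>i = 1..N. (w i)\<^sup>2 * x i i)\<bar> \<le> 1 / (2 * (N * m)) * (T * ?K)"
    using N m unfolding abs_mult T_def sum_distrib_right by (intro mult_mono) auto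
  then have "\<bar>1 / (2 * (N * m)) * (\<Sum>i = 1..N. (w i)\<^sup>2 * x i i)\<bar> \<le> ?K / (2 * (N * m)) * T"
    by (simp add: mult.commute)
  with offdiag show ?thesis unfolding emp x_def by linarith
qed

lemma abs_sum_ln_edge_factor_le:
  fixes \<Phi> :: "'a \<times> 'a \<Rightarrow> real" and w :: "nat \<Rightarrow> real"
  assumes C: "\<And>z. \<bar>\<Phi> z\<bar> \<le> C"
    and w: "\<And>i. i \<in> {1..N} \<Longrightarrow> 0 < w i"
    and N: "0 < N"
  shows "\<bar>\<Sum>(i, j)\<in>vertex_pairs N. ln (1 + edge_prob N w (i, j) * (exp (\<Phi> (\<sigma> i, \<sigma> j)) - 1))\<bar>
    \<le> (exp C)\<^sup>2 * (\<Sum>i = 1..N. w i)"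
proof -
  let ?V = "vertex_pairs N" and ?K = "exp C"
  define S where "S = (\<Sum>i = 1..N. w i)"
  have S: "0 < S" unfolding S_def using w N by (intro sum_pos) auto
  have "\<bar>\<Sum>(i, j)\<in>?V. ln (1 + edge_prob N w (i, j) * (exp (\<Phi> (\<sigma> i, \<sigma> j)) - 1))\<bar>
      \<le> (\<Sum>(i, j)\<in>?V. ?K\<^sup>2 / S * (w i * w j))"
  proof (rule order.trans[OF sum_abs], rule sum_mono, unfold split_paired_all prod.case)
    fix i j assume e: "(i, j) \<in> ?V"
    let ?p = "edge_prob N w (i, j)" and ?x = "exp (\<Phi> (\<sigma> i, \<sigma> j)) - 1"
    have p: "0 \<le> ?p" "?p \<le> 1" using edge_prob_bounds[of N w, OF w e] by auto
    note x = exp_minus_one_bounds[OF C[of "(\<sigma> i, \<sigma> j)"]]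
    have "0 < w i * w j" using w e by (auto simp: vertex_pairs_def)
    then have "?p \<le> w i * w j / S"
      unfolding edge_prob_def prod.case S_def[symmetric] using S by (intro frac_le) auto
    then have "\<bar>?p * ?x\<bar> \<le> w i * w j / S * ?K"
      unfolding abs_mult using p x S \<open>0 < w i * w j\<close> by (intro mult_mono) auto
    then have "?K * \<bar>?p * ?x\<bar> \<le> ?K * (w i * w j / S * ?K)" by (intro mult_left_mono) auto
    also have "\<dots> = ?K\<^sup>2 / S * (w i * w j)" by (simp add: power2_eq_square)
    finally show "\<bar>ln (1 + ?p * ?x)\<bar> \<le> ?K\<^sup>2 / S * (w i * w j)"
      using abs_ln_one_plus_le(1)[OF edge_factor_ge[OF p x(2,3)] x(3)] by linarith
  qed
  also have "\<dots> = ?K\<^sup>2 / S * (\<Sum>(i, j)\<in>?V. w i * w j)"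
    by (simp only: case_prod_unfold sum_distrib_left)
  also have "\<dots> \<le> ?K\<^sup>2 / S * S\<^sup>2"
    unfolding S_def using w
    by (intro mult_left_mono sum_vertex_pairs_le divide_nonneg_nonneg sum_nonneg)
      (auto intro: less_imp_le)
  also have "\<dots> = ?K\<^sup>2 * S" using S by (simp add: power2_eq_square)
  finally show ?thesis by (simp add: S_def)
qed

section \<open>Passage to the limit\<close>

lemma empirical_mean_conv:
  assumes "prob_space M" "W \<in> borel_measurable M"
    and "weak_conv_m (\<lambda>N. distr (empirical N (w N)) borel (\<lambda>x. x)) (distr M borel W)"
    and "integrable M (\<lambda>x. (W x)\<^sup>2)"
    and "(\<lambda>N. measure_pmf.expectation (empirical N (w N)) (\<lambda>x. x\<^sup>2)) \<longlonglongrightarrow> L"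
  shows "(\<lambda>N. (\<Sum>i = 1..N. w N i) / real N) \<longlonglongrightarrow> prob_space.expectation M W"
proof -
  interpret prob_space M by fact
  have "(\<lambda>N. \<integral>x. x \<partial>distr (empirical N (w N)) borel (\<lambda>x. x)) \<longlonglongrightarrow> (\<integral>x. x \<partial>distr M borel W)"
  proof (rule weak_conv_imp_mean_conv[OF _ _ assms(3)])
    show "real_distribution (distr (measure_pmf (empirical N (w N))) borel (\<lambda>x. x))" for N
      by (intro prob_space.real_distribution_distr) (auto intro: measure_pmf.prob_space_axioms)
    show "real_distribution (distr M borel W)"
      using assms(2) by (rule real_distribution_distr)
    \<comment> \<open>For \<open>N > 0\<close> the support is finite; at \<open>N = 0\<close> the
      uniform law on the empty set is unspecified, hence the restriction to large
      \<open>N\<close>.\<close>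
    show "\<forall>\<^sub>F N in sequentially. integrable (distr (measure_pmf (empirical N (w N))) borel (\<lambda>x. x)) (\<lambda>x. x\<^sup>2)"
      using eventually_gt_at_top[of 0]
      by eventually_elim
        (simp add: integrable_distr_eq integrable_measure_pmf_finite empirical_def)
    show "integrable (distr M borel W) (\<lambda>x. x\<^sup>2)"
      using assms(2,4) by (simp add: integrable_distr_eq)
    show "(\<lambda>N. \<integral>x. x\<^sup>2 \<partial>distr (measure_pmf (empirical N (w N))) borel (\<lambda>x. x)) \<longlonglongrightarrow> L"
      using assms(5) by (simp add: integral_distr)
  qed
  then have lim: "(\<lambda>N. measure_pmf.expectation (empirical N (w N)) (\<lambda>x. x)) \<longlonglongrightarrow> expectation W"
    using assms(2) by (simp add: integral_distr)
  show ?thesis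
    by (rule Lim_transform_eventually[OF lim])
      (auto intro!: eventually_mono[OF eventually_gt_at_top[of 0]] simp: expectation_empirical)
qed

theorem proposition2p4:
  fixes \<alpha> :: "'a::polish_space measure"
    and \<Phi> :: "'a \<times> 'a \<Rightarrow> real"
    and w :: "nat \<Rightarrow> nat \<Rightarrow> real"
    and M :: "'b measure"
    and W :: "'b \<Rightarrow> real"
    and \<psi> :: real
  assumes "prob_space \<alpha>" and "sets \<alpha> = sets borel"
    and "\<Phi> \<in> borel_measurable borel" and "bounded (range \<Phi>)"
    and "\<And>x y. \<Phi> (x, y) = \<Phi> (y, x)"
    and "\<And>N i. i \<in> {1..N} \<Longrightarrow> 0 < w N i"
    and "prob_space M" and "W \<in> borel_measurable M"
    and "weak_conv_m (\<lambda>N. distr (empirical N (w N)) borel (\<lambda>x. x)) (distr M borel W)"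
    and "integrable M (\<lambda>x. (W x)\<^sup>2)"
    and "(\<lambda>N. measure_pmf.expectation (empirical N (w N)) (\<lambda>x. x\<^sup>2))
           \<longlonglongrightarrow> prob_space.expectation M (\<lambda>x. (W x)\<^sup>2)"
    and "(\<lambda>N. annealed_pressure \<Phi> \<alpha> (w N) N) \<longlonglongrightarrow> \<psi>"
  shows "(\<lambda>N. 1 / real N * ln (\<integral>\<sigma>. exp (real N *
            empirical_square N \<sigma> (w N) (interaction \<Phi> (prob_space.expectation M W)))
              \<partial>spin_product \<alpha> N)) \<longlonglongrightarrow> \<psi>"
proof -
  define m where "m = prob_space.expectation M W"
  define s where "s = prob_space.expectation M (\<lambda>x. (W x)\<^sup>2)"
  define S where "S N = (\<Sum>i = 1..N. w N i)" for N
  define T where "T N = (\<Sum>i = 1..N. (w N i)\<^sup>2)" for N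
  let ?A = "\<lambda>N. annealed_pressure \<Phi> \<alpha> (w N) N"
  let ?G = "\<lambda>N \<sigma>. real N * empirical_square N \<sigma> (w N) (interaction \<Phi> m)"
  let ?B = "\<lambda>N. 1 / real N * ln (\<integral>\<sigma>. exp (?G N \<sigma>) \<partial>spin_product \<alpha> N)"
  obtain C where C: "\<And>z. \<bar>\<Phi> z\<bar> \<le> C"
    using assms(4) by (auto simp: bounded_iff)
  have limS: "(\<lambda>N. S N / real N) \<longlonglongrightarrow> m"
    unfolding S_def m_def by (rule empirical_mean_conv[OF assms(7-11)])
  have limT: "(\<lambda>N. T N / real N) \<longlonglongrightarrow> s"
    unfolding s_def T_def
    by (rule Lim_transform_eventually[OF assms(11)])
      (auto intro!: eventually_mono[OF eventually_gt_at_top[of 0]] simp: expectation_empirical)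
  have S: "0 < S N" if "0 < N" for N
    unfolding S_def using assms(6) that by (intro sum_pos) auto
  have m: "0 \<le> m"
    using S by (intro tendsto_lowerbound[OF limS] eventually_mono[OF eventually_gt_at_top[of 0]])
      (auto intro: less_imp_le)
  have G: "?G N \<in> borel_measurable (spin_product \<alpha> N)" if "0 < N" for N
    using that unfolding empirical_square_eq[OF that] interaction_def prod.case
    by (intro borel_measurable_times borel_measurable_const borel_measurable_sum
        borel_measurable_diff measurable_compose[OF _ borel_measurable_exp]
        measurable_pair_interaction[OF assms(2,3)])
  \<comment> \<open>The goal reduces to this: the two exponents differ by \<open>o(N)\<close>,
    uniformly in \<open>\<sigma>\<close>.\<close>
  have "\<exists>D. (\<forall>\<^sub>F N in sequentially. \<forall>\<sigma>. \<bar>(\<Sum>(i, j)\<in>vertex_pairs N.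
        ln (1 + edge_prob N (w N) (i, j) * (exp (\<Phi> (\<sigma> i, \<sigma> j)) - 1))) - ?G N \<sigma>\<bar> \<le> D N) \<and>
      (\<lambda>N. D N / real N) \<longlonglongrightarrow> 0"
  proof (cases "m = 0")
    case True
    \<comment> \<open>Division by zero makes \<^term>\<open>interaction \<Phi> 0\<close> vanish.\<close>
    have "?G N \<sigma> = 0" if "0 < N" for N \<sigma>
      using that True by (simp add: empirical_square_eq interaction_def)
    moreover have "(\<lambda>N. (exp C)\<^sup>2 * S N / real N) \<longlonglongrightarrow> 0"
      using tendsto_mult_left[OF limS, of "(exp C)\<^sup>2"] True by simp
    ultimately show ?thesis
      unfolding S_def
      using abs_sum_ln_edge_factor_le[of \<Phi> C _ "w _", OF C assms(6)]
      by (intro exI[of _ "\<lambda>N. (exp C)\<^sup>2 * (\<Sum>i = 1..N. w N i)"] conjI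
          eventually_mono[OF eventually_gt_at_top[of 0]]) auto
  next
    case False
    with m have m: "0 < m" by simp
    let ?D = "\<lambda>N. 2 * exp C ^ 3 * (T N / S N)\<^sup>2 + exp C * \<bar>1 / S N - 1 / (N * m)\<bar> * (S N)\<^sup>2
      + exp C / (2 * (N * m)) * T N"
    \<comment> \<open>This is \<open>?D N / real N\<close> written as a continuous function of
      \<open>S N / N\<close>, \<open>T N / N\<close> and \<open>1 / N\<close>, so the limit can be
      read off. The outer terms vanish through \<open>1 / N\<close>, the middle one because
      \<open>S N / N\<close> tends to \<open>m\<close>.\<close>
    have "(\<lambda>N. 2 * exp C ^ 3 * ((T N / N) / (S N / N))\<^sup>2 * inverse (real N)
        + exp C * \<bar>1 / (S N / N) - 1 / m\<bar> * (S N / N)\<^sup>2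
        + exp C / (2 * m) * (T N / N) * inverse (real N))
      \<longlonglongrightarrow> 2 * exp C ^ 3 * (s / m)\<^sup>2 * 0 + exp C * \<bar>1 / m - 1 / m\<bar> * m\<^sup>2 + exp C / (2 * m) * s * 0"
      using m by (intro tendsto_intros limS limT lim_inverse_n) auto
    then have "(\<lambda>N. 2 * exp C ^ 3 * ((T N / N) / (S N / N))\<^sup>2 * inverse (real N)
        + exp C * \<bar>1 / (S N / N) - 1 / m\<bar> * (S N / N)\<^sup>2
        + exp C / (2 * m) * (T N / N) * inverse (real N)) \<longlonglongrightarrow> 0"
      by simp
    moreover have "2 * exp C ^ 3 * ((T N / N) / (S N / N))\<^sup>2 * inverse (real N)
        + exp C * \<bar>1 / (S N / N) - 1 / m\<bar> * (S N / N)\<^sup>2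
        + exp C / (2 * m) * (T N / N) * inverse (real N) = ?D N / real N" if "0 < N" for N
    proof -
      have "1 / (S N / N) - 1 / m = real N * (1 / S N - 1 / (N * m))"
        using that by (simp add: field_simps)
      then have "\<bar>1 / (S N / N) - 1 / m\<bar> = real N * \<bar>1 / S N - 1 / (N * m)\<bar>"
        by (simp only: abs_mult abs_of_nat)
      moreover have "(T N / N) / (S N / N) = T N / S N" using that by simp
      ultimately show ?thesis using that m
        by (simp only: add_divide_distrib) (simp add: field_simps power2_eq_square)
    qed
    ultimately have "(\<lambda>N. ?D N / real N) \<longlonglongrightarrow> 0"
      by (elim Lim_transform_eventually) (auto intro: eventually_mono[OF eventually_gt_at_top[of 0]])
    moreover have "\<forall>\<^sub>F N in sequentially. \<forall>\<sigma>. \<bar>(\<Sum>(i, j)\<in>vertex_pairs N.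
        ln (1 + edge_prob N (w N) (i, j) * (exp (\<Phi> (\<sigma> i, \<sigma> j)) - 1))) - ?G N \<sigma>\<bar> \<le> ?D N"
      using eventually_gt_at_top[of 0]
    proof eventually_elim
      case (elim N)
      show ?case
        unfolding S_def T_def
        using sum_ln_edge_factor_diff_le[of \<Phi> C N "w N" m, OF C assms(5,6) elim m] by blast
    qed
    ultimately show ?thesis by (intro exI[of _ ?D] conjI)
  qed
  then obtain D where D: "(\<lambda>N. D N / real N) \<longlonglongrightarrow> 0"
    "\<forall>\<^sub>F N in sequentially. \<forall>\<sigma>. \<bar>(\<Sum>(i, j)\<in>vertex_pairs N.
        ln (1 + edge_prob N (w N) (i, j) * (exp (\<Phi> (\<sigma> i, \<sigma> j)) - 1))) - ?G N \<sigma>\<bar> \<le> D N"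
    by blast
  have "\<forall>\<^sub>F N in sequentially. norm (?A N - ?B N) \<le> D N / real N"
    using D(2) eventually_gt_at_top[of 0]
  proof eventually_elim
    case (elim N)
    then show ?case
      unfolding real_norm_def
      by (intro annealed_pressure_diff_le[OF assms(1-3) C assms(6) G]) auto
  qed
  then have "(\<lambda>N. ?A N - ?B N) \<longlonglongrightarrow> 0"
    by (rule Lim_null_comparison[OF _ D(1)])
  \<comment> \<open>The assumed limit carries over since
    \<open>?B N = ?A N - (?A N - ?B N)\<close>.\<close>
  from tendsto_diff[OF assms(12) this] show ?thesis
    unfolding m_def by simp
qed

end
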